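(* Let $\lambda\in\mathbb{R}$ and let $m,r\in\mathbb{Z}$ with $m\ge r\ge 0$. Then, as operators acting on formal power series in $\mathbb{C}[[x]]$, $$\left(x\frac{d}{dx}\right)_{m,\lambda}x^{r}=\sum_{l=0}^{m}{m+r \brace l+r}_{r,\lambda}\,x^{l+r}\left(\frac{d}{dx}\right)^{l}.$$ In particular, also $$\left(x\frac{d}{dx}\right)_{m-r,\lambda}x^{r}\left(\frac{d}{dx}\right)^{r}=\sum_{l=r}^{m}{m \brace l}_{r,\lambda}\,x^{l}\left(\frac{d}{dx}\right)^{l}.$$
   Context: Degenerate falling factorials: $(y)_{0,\lambda}=1$ and $(y)_{n,\lambda}=y(y-\lambda)\cdots(y-(n-1)\lambda)$ for $n\ge1$; ordinary falling factorials: $(y)_0=1$, $(y)_n=y(y-1)\cdots(y-n+1)$. For the operator $\theta=x\frac{d}{dx}$, $(\theta)_{m,\lambda}$ denotes the operator $\theta(\theta-\lambda)\cdots(\theta-(m-1)\lambda)$ (the identity if $m=0$). The symbol $x^{r}$ in an operator product denotes multiplication by $x^{r}$, and products of operators are compositions (rightmost factor applied first). For an integer $r\ge0$, the degenerate $r$-Stirling numbers of the second kind ${n+r \brace k+r}_{r,\lambda}$ ($0\le k\le n$) are defined by the polynomial identity $(y+r)_{n,\lambda}=\sum_{k=0}^{n}{n+r \brace k+r}_{r,\lambda}(y)_{k}$ for $n\ge0$. Thus for $r\le l\le m$, ${m \brace l}_{r,\lambda}$ is the number obtained with $n=m-r$, $k=l-r$. *)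

theory Defs
  imports Complex_Main "HOL-Computational_Algebra.Polynomial"
    "HOL-Computational_Algebra.Formal_Power_Series"
begin

definition degen_ffact :: "'a::comm_ring_1 \<Rightarrow> 'a \<Rightarrow> nat \<Rightarrow> 'a"
  where "degen_ffact lam y n = (\<Prod>i<n. y - of_nat i * lam)"

definition ffact :: "'a::comm_ring_1 \<Rightarrow> nat \<Rightarrow> 'a"
  where "ffact y n = (\<Prod>i<n. y - of_nat i)"

text \<open>The coefficients of \<open>(y + r)\<^bsub>n,\<lambda>\<^esub>\<close> with respect to the basis \<open>(y)\<^sub>k\<close>, as an identity in
  \<open>\<real>[y]\<close>; the indeterminate \<open>y\<close> is \<open>[:0, 1:]\<close>. Requiring the values beyond \<open>n\<close> to be zero only
  serves to make the coefficient function unique.\<close>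

definition degen_rStirling_coeffs :: "nat \<Rightarrow> real \<Rightarrow> nat \<Rightarrow> (nat \<Rightarrow> real) \<Rightarrow> bool"
  where "degen_rStirling_coeffs r lam n c \<longleftrightarrow>
    degen_ffact [:lam:] ([:0, 1:] + of_nat r) n = (\<Sum>k=0..n. smult (c k) (ffact [:0, 1:] k))
    \<and> (\<forall>k>n. c k = 0)"

text \<open>The arguments \<open>a\<close> and \<open>b\<close> are the upper and lower entries of the brace symbol, that is
  \<open>a = n + r\<close> and \<open>b = k + r\<close>. The definition is meaningful only for \<open>r \<le> a\<close> and \<open>r \<le> b\<close>.\<close>

definition degen_rStirling :: "nat \<Rightarrow> real \<Rightarrow> nat \<Rightarrow> nat \<Rightarrow> real"
  where "degen_rStirling r lam a b = (THE c. degen_rStirling_coeffs r lam (a - r) c) (b - r)"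

lemma ffact_pCons: "degree (ffact [:0, 1::real:] k) = k \<and> coeff (ffact [:0, 1::real:] k) k = 1"
proof (induction k)
  case 0
  show ?case by (simp add: ffact_def)
next
  case (Suc k)
  let ?p = "ffact [:0, 1::real:] k"
  have e: "ffact [:0, 1::real:] (Suc k) = ?p * [:- of_nat k, 1:]"
    by (simp add: ffact_def of_nat_poly)
  have nz: "?p \<noteq> 0" using Suc by auto
  have d: "degree (?p * [:- of_nat k, 1:]) = Suc k"
    using Suc nz by (subst degree_mult_eq) auto
  have "lead_coeff (?p * [:- of_nat k, 1:]) = 1"
    using Suc by (simp only: lead_coeff_mult) simp
  then show ?case using d e by simp
qed

lemma ffact_basis_exists:
  fixes p :: "real poly"
  assumes "degree p \<le> n"
  shows "\<exists>c. p = (\<Sum>k=0..n. smult (c k) (ffact [:0, 1:] k)) \<and> (\<forall>k>n. c k = 0)"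
  using assms
proof (induction n arbitrary: p)
  case 0
  then obtain a where "p = [:a:]" by (auto elim: degree_eq_zeroE)
  then show ?case by (intro exI[of _ "\<lambda>k. if k = 0 then a else 0"]) (simp add: ffact_def)
next
  case (Suc n)
  let ?q = "p - smult (coeff p (Suc n)) (ffact [:0, 1:] (Suc n))"
  have "degree ?q \<le> n"
  proof (rule degree_le, intro allI impI)
    fix i assume "i > n"
    then show "coeff ?q i = 0"
      using Suc.prems ffact_pCons[of "Suc n"]
      by (cases "i = Suc n") (auto simp: coeff_eq_0)
  qed
  from Suc.IH[OF this] obtain c where
    c: "?q = (\<Sum>k=0..n. smult (c k) (ffact [:0, 1:] k))" "\<forall>k>n. c k = 0" by blast
  let ?c = "c(Suc n := coeff p (Suc n))"
  have "(\<Sum>k=0..n. smult (?c k) (ffact [:0, 1:] k)) = ?q"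
    unfolding c(1) by (intro sum.cong) auto
  then show ?case using c(2) by (intro exI[of _ ?c]) (auto simp: algebra_simps)
qed

lemma ffact_basis_unique:
  fixes d :: "nat \<Rightarrow> real"
  assumes "(\<Sum>k=0..n. smult (d k) (ffact [:0, 1:] k)) = 0" "k \<le> n"
  shows "d k = 0"
  using assms
proof (induction n)
  case 0
  then show ?case by (simp add: ffact_def)
next
  case (Suc n)
  have "coeff (\<Sum>k=0..n. smult (d k) (ffact [:0, 1:] k)) (Suc n) = 0"
    by (auto simp: coeff_sum coeff_eq_0 ffact_pCons intro!: sum.neutral)
  then have "d (Suc n) = 0"
    using arg_cong[OF Suc.prems(1), of "\<lambda>p. coeff p (Suc n)"] ffact_pCons[of "Suc n"] by simp
  then show ?case using Suc by (cases "k = Suc n") auto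
qed

lemma degen_rStirling_coeffs_ex1: "\<exists>!c. degen_rStirling_coeffs r lam n c"
proof (rule ex_ex1I)
  have "degree (degen_ffact [:lam:] ([:0, 1:] + of_nat r) n) \<le> n"
  proof (induction n)
    case 0
    show ?case by (simp add: degen_ffact_def)
  next
    case (Suc n)
    have e: "degen_ffact [:lam:] ([:0, 1:] + of_nat r) (Suc n) =
      degen_ffact [:lam:] ([:0, 1:] + of_nat r) n * [:of_nat r - of_nat n * lam, 1:]"
      by (simp add: degen_ffact_def of_nat_poly mult.commute)
    show ?case unfolding e by (rule order_trans[OF degree_mult_le]) (use Suc in simp)
  qed
  then show "\<exists>c. degen_rStirling_coeffs r lam n c"
    unfolding degen_rStirling_coeffs_def by (rule ffact_basis_exists)
next
  fix c c'
  assume c: "degen_rStirling_coeffs r lam n c" "degen_rStirling_coeffs r lam n c'"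
  then have "(\<Sum>k=0..n. smult (c k - c' k) (ffact [:0, 1:] k)) = 0"
    by (simp add: degen_rStirling_coeffs_def smult_diff_left sum_subtractf)
  then have "c k - c' k = 0" if "k \<le> n" for k
    using ffact_basis_unique[of "\<lambda>k. c k - c' k"] that by blast
  moreover have "c k = c' k" if "k > n" for k
    using c that by (simp add: degen_rStirling_coeffs_def)
  ultimately show "c = c'" by (metis eq_iff_diff_eq_0 ext not_le)
qed

lemma degen_rStirling_identity:
  "degen_ffact [:lam:] ([:0, 1:] + of_nat r) n =
    (\<Sum>k=0..n. smult (degen_rStirling r lam (n + r) (k + r)) (ffact [:0, 1:] k))"
  using theI'[OF degen_rStirling_coeffs_ex1[of r lam n]]
  by (simp add: degen_rStirling_def degen_rStirling_coeffs_def)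

definition fps_theta :: "complex fps \<Rightarrow> complex fps"
  where "fps_theta f = fps_X * fps_deriv f"

text \<open>The product \<open>T (T - \<lambda>) \<dots> (T - (m - 1) \<lambda>)\<close> of operators, rightmost factor applied first.\<close>

primrec op_degen_ffact ::
  "real \<Rightarrow> (complex fps \<Rightarrow> complex fps) \<Rightarrow> nat \<Rightarrow> complex fps \<Rightarrow> complex fps"
  where
    "op_degen_ffact lam T 0 = id"
  | "op_degen_ffact lam T (Suc m) =
       op_degen_ffact lam T m \<circ> (\<lambda>f. T f - fps_const (of_real (of_nat m * lam)) * f)"

end

theory Submission imports Defs begin

text \<open>
  Every operator in the statement is, up to the shift by \<open>x\<^sup>r\<close>, diagonal on the monomials \<open>x\<^sup>j\<close>:
  \<open>\<theta>\<close> has eigenvalue \<open>j\<close>, so \<open>(\<theta>)\<^bsub>m,\<lambda>\<^esub>\<close> has eigenvalue \<open>(j)\<^bsub>m,\<lambda>\<^esub>\<close>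
  (\<open>fps_nth_op_degen_ffact_theta\<close>), while \<open>x\<^sup>l (d/dx)\<^sup>l\<close> has eigenvalue \<open>(j)\<^sub>l\<close>
  (\<open>fps_nth_X_power_mult_deriv_power\<close>). Multiplication by \<open>x\<^sup>r\<close> sends \<open>x\<^sup>j\<close> to \<open>x\<^bsup>j+r\<^esup>\<close>, so the
  coefficient of \<open>x\<^bsup>j+r\<^esup>\<close> on the two sides of the first identity is the coefficient of \<open>x\<^sup>j\<close> in the
  argument, multiplied by \<open>(j + r)\<^bsub>m,\<lambda>\<^esub>\<close> on the left and by the corresponding combination of the
  \<open>(j)\<^sub>l\<close> on the right. These numbers agree because they are the two sides of the polynomial
  identity that defines the degenerate \<open>r\<close>-Stirling numbers, evaluated at \<open>y = j\<close>
  (\<open>degen_ffact_add_eq_sum_ffact\<close>).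

  The second identity is the first one with \<open>m - r\<close> in place of \<open>m\<close>, applied to the \<open>r\<close>-th
  derivative of the argument.
\<close>

unbundle fps_syntax

lemma poly_ffact: "poly (ffact p k) y = ffact (poly p y) k"
  for y :: "'a::comm_ring_1"
  by (simp add: ffact_def poly_prod of_nat_poly)

lemma poly_degen_ffact: "poly (degen_ffact [:lam:] p n) y = degen_ffact lam (poly p y) n"
  for y :: "'a::comm_ring_1"
  by (simp add: degen_ffact_def poly_prod of_nat_poly mult.commute)

lemma degen_ffact_add_eq_sum_ffact:
  "degen_ffact lam (y + of_nat r) n =
    (\<Sum>k=0..n. degen_rStirling r lam (n + r) (k + r) * ffact y k)"
proof -
  have "poly (degen_ffact [:lam:] ([:0, 1:] + of_nat r) n) y =
      (\<Sum>k=0..n. degen_rStirling r lam (n + r) (k + r) * ffact y k)"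
    unfolding degen_rStirling_identity by (simp add: poly_sum poly_ffact)
  then show ?thesis
    by (simp add: poly_degen_ffact of_nat_poly add.commute)
qed

lemma ffact_Suc_left: "ffact y (Suc l) = y * ffact (y - 1) l"
  unfolding ffact_def prod.lessThan_Suc_shift by (simp add: algebra_simps)

lemma fps_nth_theta: "fps_theta f $ j = of_nat j * f $ j"
  by (cases j) (simp_all add: fps_theta_def)

lemma fps_nth_op_degen_ffact_theta:
  "op_degen_ffact lam fps_theta m f $ j = of_real (degen_ffact lam (of_nat j) m) * f $ j"
  by (induction m arbitrary: f) (simp_all add: degen_ffact_def fps_nth_theta algebra_simps)

text \<open>For \<open>j < l\<close> both sides vanish, the falling factorial because it contains the factor \<open>j - j\<close>,
  so the terms of the operator identity with \<open>l > j\<close> need no separate treatment.\<close>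

lemma fps_nth_X_power_mult_deriv_power:
  fixes f :: "'a::comm_ring_1 fps"
  shows "(fps_X ^ l * (fps_deriv ^^ l) f) $ j = ffact (of_nat j) l * f $ j"
proof (induction l arbitrary: f j)
  case 0
  show ?case by (simp add: ffact_def)
next
  case (Suc l)
  have "(fps_X ^ Suc l * (fps_deriv ^^ Suc l) f) $ j =
      (fps_X * (fps_X ^ l * (fps_deriv ^^ l) (fps_deriv f))) $ j"
    by (simp add: funpow_swap1 mult.assoc)
  also have "\<dots> = ffact (of_nat j) (Suc l) * f $ j"
  proof (cases j)
    case 0
    then show ?thesis by (simp add: ffact_Suc_left)
  next
    case (Suc i)
    then show ?thesis
      by (simp only: fps_X_mult_nth Suc.IH) (simp add: ffact_Suc_left algebra_simps)
  qed
  finally show ?case .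
qed

lemma of_real_ffact: "of_real (ffact y k) = (ffact (of_real y) k :: 'a::{real_algebra_1,comm_ring_1})"
  by (simp add: ffact_def)

lemma op_degen_ffact_theta_X_power:
  "op_degen_ffact lam fps_theta m (fps_X ^ r * f) =
    (\<Sum>l=0..m. fps_const (of_real (degen_rStirling r lam (m + r) (l + r)))
      * (fps_X ^ (l + r) * (fps_deriv ^^ l) f))" (is "?L = (\<Sum>l=0..m. ?R l)")
proof (rule fps_ext)
  fix n
  have split: "fps_X ^ (l + r) * (fps_deriv ^^ l) f = fps_X ^ r * (fps_X ^ l * (fps_deriv ^^ l) f)"
    for l by (simp add: power_add mult_ac)
  show "?L $ n = (\<Sum>l=0..m. ?R l) $ n"
  proof (cases "n < r")
    case True
    then show ?thesis
      by (simp add: fps_nth_op_degen_ffact_theta fps_sum_nth split fps_X_power_mult_nth)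
  next
    case False
    then obtain j where n: "n = j + r"
      by (metis add.commute le_Suc_ex not_less)
    have nth_R: "(fps_X ^ (l + r) * (fps_deriv ^^ l) f) $ n = ffact (of_nat j) l * f $ j" for l
      unfolding split n fps_X_power_mult_nth[of r]
      by (simp add: fps_nth_X_power_mult_deriv_power)
    have "?L $ n = of_real (degen_ffact lam (of_nat j + of_nat r) m) * f $ j"
      by (simp add: n fps_nth_op_degen_ffact_theta fps_X_power_mult_nth)
    also have "\<dots> = (\<Sum>l=0..m. of_real (degen_rStirling r lam (m + r) (l + r))
        * (ffact (of_nat j) l * f $ j))"
      by (simp add: degen_ffact_add_eq_sum_ffact of_real_ffact sum_distrib_right mult.assoc)
    also have "\<dots> = (\<Sum>l=0..m. ?R l) $ n"
      by (simp add: fps_sum_nth nth_R)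
    finally show ?thesis .
  qed
qed

theorem theorem1:
  fixes lam :: real and m r :: nat
  assumes "r \<le> m"
  shows "op_degen_ffact lam fps_theta m \<circ> (\<lambda>f. fps_X ^ r * f) =
      (\<lambda>f. \<Sum>l=0..m. fps_const (of_real (degen_rStirling r lam (m + r) (l + r)))
        * (fps_X ^ (l + r) * (fps_deriv ^^ l) f))
    \<and> op_degen_ffact lam fps_theta (m - r) \<circ> (\<lambda>f. fps_X ^ r * f) \<circ> (fps_deriv ^^ r) =
      (\<lambda>f. \<Sum>l=r..m. fps_const (of_real (degen_rStirling r lam m l))
        * (fps_X ^ l * (fps_deriv ^^ l) f))"
proof (intro conjI ext)
  fix f
  show "(op_degen_ffact lam fps_theta m \<circ> (\<lambda>f. fps_X ^ r * f)) f =
      (\<Sum>l=0..m. fps_const (of_real (degen_rStirling r lam (m + r) (l + r)))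
        * (fps_X ^ (l + r) * (fps_deriv ^^ l) f))"
    by (simp add: op_degen_ffact_theta_X_power)
  let ?S = "\<lambda>l. fps_const (of_real (degen_rStirling r lam m l)) * (fps_X ^ l * (fps_deriv ^^ l) f)"
  have "(op_degen_ffact lam fps_theta (m - r) \<circ> (\<lambda>f. fps_X ^ r * f) \<circ> (fps_deriv ^^ r)) f =
      (\<Sum>l=0..m - r. ?S (l + r))"
    using assms by (simp add: op_degen_ffact_theta_X_power funpow_add)
  also have "\<dots> = (\<Sum>l=r..m. ?S l)"
    using assms sum.shift_bounds_cl_nat_ivl[of ?S 0 r "m - r"] by simp
  finally show "(op_degen_ffact lam fps_theta (m - r) \<circ> (\<lambda>f. fps_X ^ r * f) \<circ> (fps_deriv ^^ r)) f =
      (\<Sum>l=r..m. ?S l)" .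
qed

end
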